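(* Let $\mathcal{R}'$ be the class of all positive functions $r$ defined on $\mathbb{R}$ such that $x\mapsto f(x)r^{-1}(a^\top x)$ is a density on $\mathbb{R}^d$ for all $a\in\mathbb{R}^d_*$ (where $r^{-1}=1/r$). There exists a vector $a\in\mathbb{R}^d_*$ such that $$\arg\min_{r\in\mathcal{R}'}K(g,fr^{-1})=\frac{f_a}{g_a}\quad\text{and}\quad r(a^\top x)=\frac{f_a(a^\top x)}{g_a(a^\top x)},$$ where $fr^{-1}$ denotes $x\mapsto f(x)r^{-1}(a^\top x)$ and the $r$ in the second equality is the minimiser. Moreover, $$K(g,f)=K(g_a,f_a)+K\Big(g,f\frac{g_a}{f_a}\Big).$$
   Context: $\mathbb{R}^d_*$ is the set of nonzero vectors of $\mathbb{R}^d$. If $h$ is the density of a random vector $Z$ in $\mathbb{R}^d$, $h_a$ denotes the density of $a^\top Z$ on $\mathbb{R}$; $f\frac{g_a}{f_a}$ denotes $x\mapsto f(x)\frac{g_a(a^\top x)}{f_a(a^\top x)}$. $K(p,q)=\int p\ln(p/q)$ is the relative entropy (Kullback-Leibler divergence), $+\infty$ when absolute continuity fails. $f$ is a density on $\mathbb{R}^d$ and $g$ is an elliptical density on $\mathbb{R}^d$ with the same mean and variance as $f$; elliptical means of the form $\frac{c_d}{|\Sigma|^{1/2}}\xi_d(\frac12(x-\mu)^\top\Sigma^{-1}(x-\mu))$ with $\mu\in\mathbb{R}^d$, $\Sigma$ a $d\times d$ positive-definite matrix, $\xi_d$ a function called the density generator, and $c_d$ a normalising constant.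
   Formalization: The density condition defining R' is imposed for the chosen a only, not for all a; f_a and g_a are assumed positive; the minimiser is identified with f_a/g_a almost everywhere, and its uniqueness is claimed only when the minimum is finite. *)

theory Defs
  imports "HOL-Probability.Probability"
begin

definition is_density :: "('a::euclidean_space \<Rightarrow> real) \<Rightarrow> bool" where
  "is_density h \<longleftrightarrow> h \<in> borel_measurable borel \<and> (\<forall>x. 0 \<le> h x) \<and>
     (\<integral>\<^sup>+ x. ennreal (h x) \<partial>lborel) = 1"

definition positive_definite :: "real^'n^'n \<Rightarrow> bool" where
  "positive_definite S \<longleftrightarrow> transpose S = S \<and> (\<forall>v. v \<noteq> 0 \<longrightarrow> 0 < v \<bullet> (S *v v))"

text \<open>The normalising constant \<open>c\<close> is not given by a formula: it is determined by the
  generator \<open>\<xi>\<close>, because \<open>g\<close> has total mass one.\<close>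

definition elliptical_density :: "(real^'n \<Rightarrow> real) \<Rightarrow> bool" where
  "elliptical_density g \<longleftrightarrow> is_density g \<and>
     (\<exists>(\<mu>::real^'n) (S::real^'n^'n) (\<xi>::real \<Rightarrow> real) (c::real).
        positive_definite S \<and>
        (\<forall>x. g x = c / sqrt (det S) * \<xi> (1/2 * ((x - \<mu>) \<bullet> (matrix_inv S *v (x - \<mu>))))))"

text \<open>For a density, a finite second moment makes the Bochner integrals in
  \<open>mean_of\<close> and \<open>variance_of\<close> converge; without it they may be the default value 0.\<close>

definition finite_second_moment :: "(real^'n \<Rightarrow> real) \<Rightarrow> bool" where
  "finite_second_moment h \<longleftrightarrow> integrable lborel (\<lambda>x. h x * (norm x)\<^sup>2)"

definition mean_of :: "(real^'n \<Rightarrow> real) \<Rightarrow> real^'n" where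
  "mean_of h = (\<integral>x. h x *\<^sub>R x \<partial>lborel)"

definition variance_of :: "(real^'n \<Rightarrow> real) \<Rightarrow> real^'n^'n" where
  "variance_of h = (\<chi> i j. \<integral>x. h x * ((x $ i - mean_of h $ i) * (x $ j - mean_of h $ j)) \<partial>lborel)"

text \<open>\<open>proj_density h a k\<close>: if \<open>Z\<close> has density \<open>h\<close>, then \<open>k\<close> is a (version of the) density
  of the real random variable \<open>a \<bullet> Z\<close>.\<close>

definition proj_density :: "('a::euclidean_space \<Rightarrow> real) \<Rightarrow> 'a \<Rightarrow> (real \<Rightarrow> real) \<Rightarrow> bool" where
  "proj_density h a k \<longleftrightarrow> (\<forall>t. 0 \<le> k t) \<and>
     distributed (density lborel (\<lambda>x. ennreal (h x))) lborel (\<lambda>x. a \<bullet> x) (\<lambda>t. ennreal (k t))"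

text \<open>The library's \<open>KL_divergence\<close> is real-valued and hence 0 when the integral diverges.
  For densities \<open>p\<close>, \<open>q\<close> with \<open>p\<close> absolutely continuous with respect to \<open>q\<close>, the negative part
  of \<open>p ln (p/q)\<close> is always integrable, so non-integrability means that the integral
  is \<open>\<infinity>\<close>.\<close>

definition rel_entropy :: "('a::euclidean_space \<Rightarrow> real) \<Rightarrow> ('a \<Rightarrow> real) \<Rightarrow> ereal" where
  "rel_entropy p q =
     (if absolutely_continuous (density lborel (\<lambda>x. ennreal (q x))) (density lborel (\<lambda>x. ennreal (p x)))
         \<and> integrable lborel (\<lambda>x. p x * ln (p x / q x))
      then ereal (\<integral>x. p x * ln (p x / q x) \<partial>lborel) else \<infinity>)"

definition ridge_quotient :: "('a::euclidean_space \<Rightarrow> real) \<Rightarrow> 'a \<Rightarrow> (real \<Rightarrow> real) \<Rightarrow> 'a \<Rightarrow> real" where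
  "ridge_quotient f a r = (\<lambda>x. f x * inverse (r (a \<bullet> x)))"

text \<open>The class is indexed by the direction \<open>a\<close>. Requiring the density condition
  simultaneously for all directions would in general exclude the quotient of the projected
  densities: in dimension one, for \<open>f\<close> Laplace and \<open>g\<close> normal,
  both standardised, letting the direction tend to 0 would force these
  densities to agree at 0.\<close>

definition ridge_class :: "('a::euclidean_space \<Rightarrow> real) \<Rightarrow> 'a \<Rightarrow> (real \<Rightarrow> real) set" where
  "ridge_class f a = {r. r \<in> borel_measurable borel \<and> (\<forall>t. 0 < r t) \<and> is_density (ridge_quotient f a r)}"

end

theory Submission
  imports Defs
begin

text \<open>Fix any direction \<open>a\<close>. For \<open>r\<close> in the class, \<open>s = f\<^sub>a / r\<close> is a density on the line and
  \<open>f / r = (f g\<^sub>a / f\<^sub>a) (s / g\<^sub>a)\<close>, whence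
  \<open>K(g, f / r) = K(g, f g\<^sub>a / f\<^sub>a) + K(g\<^sub>a, f\<^sub>a / r)\<close>, including infinite values.
  The case \<open>r = 1\<close> is the decomposition of \<open>K(g, f)\<close>, and Gibbs' inequality for the last
  summand shows that \<open>r = f\<^sub>a / g\<^sub>a\<close> is the minimiser.\<close>

section \<open>Densities and their one-dimensional projections\<close>

lemma is_density_iff:
  "is_density h \<longleftrightarrow> (\<forall>x. 0 \<le> h x) \<and> has_bochner_integral lborel h 1"
proof
  assume h: "is_density h"
  then show "(\<forall>x. 0 \<le> h x) \<and> has_bochner_integral lborel h 1"
    by (auto simp: is_density_def intro!: has_bochner_integral_nn_integral)
next
  assume h: "(\<forall>x. 0 \<le> h x) \<and> has_bochner_integral lborel h 1"
  then have "(\<integral>\<^sup>+x. ennreal (h x) \<partial>lborel) = ennreal (\<integral>x. h x \<partial>lborel)"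
    by (intro nn_integral_eq_integral) (auto simp: has_bochner_integral_iff)
  with h show "is_density h"
    by (auto simp: is_density_def has_bochner_integral_iff dest: borel_measurable_integrable)
qed

lemma is_density_measurable: "is_density h \<Longrightarrow> h \<in> borel_measurable borel"
  by (simp add: is_density_def)

lemma is_density_nonneg: "is_density h \<Longrightarrow> 0 \<le> h x"
  by (simp add: is_density_def)

text \<open>\<open>distributed\<close> yields measurability of the \<open>ennreal\<close>-valued
  version; since \<open>k\<close> is nonnegative, \<open>enn2real\<close> recovers \<open>k\<close>
  from it.\<close>

lemma proj_density_measurable:
  assumes "proj_density h a k"
  shows "k \<in> borel_measurable borel"
proof -
  have "(\<lambda>t. ennreal (k t)) \<in> borel_measurable borel" and nonneg: "\<And>t. 0 \<le> k t"
    using assms by (auto simp: proj_density_def distributed_def)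
  then have "(\<lambda>t. enn2real (ennreal (k t))) \<in> borel_measurable borel"
    by measurable
  then show ?thesis
    using nonneg by simp
qed

text \<open>Change of variables: both sides integrate \<open>\<phi>\<close> under the law of
  \<open>a \<bullet> Z\<close>, where \<open>Z\<close> has density \<open>h\<close>. Stating it with
  \<open>has_bochner_integral\<close> transfers integrability and value together, in both
  directions.\<close>

lemma proj_density_has_bochner_integral_iff:
  fixes \<phi> :: "real \<Rightarrow> real"
  assumes h: "is_density h" and k: "proj_density h a k" and \<phi> [measurable]: "\<phi> \<in> borel_measurable borel"
  shows "has_bochner_integral lborel (\<lambda>x. h x * \<phi> (a \<bullet> x)) I \<longleftrightarrow>
    has_bochner_integral lborel (\<lambda>t. k t * \<phi> t) I"
proof -
  note [measurable] = is_density_measurable[OF h] proj_density_measurable[OF k]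
  let ?M = "density lborel (\<lambda>x. ennreal (h x))"
  have distr: "distr ?M lborel ((\<bullet>) a) = density lborel (\<lambda>t. ennreal (k t))"
    and k0: "\<And>t. 0 \<le> k t"
    using k by (auto simp: proj_density_def distributed_def)
  have "has_bochner_integral lborel (\<lambda>x. h x * \<phi> (a \<bullet> x)) I \<longleftrightarrow>
      has_bochner_integral ?M (\<lambda>x. \<phi> (a \<bullet> x)) I"
    using is_density_nonneg[OF h]
    by (simp add: has_bochner_integral_iff integrable_density integral_density)
  also have "\<dots> \<longleftrightarrow> has_bochner_integral (distr ?M lborel ((\<bullet>) a)) \<phi> I"
    by (simp add: has_bochner_integral_iff integrable_distr_eq integral_distr)
  also have "\<dots> \<longleftrightarrow> has_bochner_integral lborel (\<lambda>t. k t * \<phi> t) I"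
    using k0 by (simp add: distr has_bochner_integral_iff integrable_density integral_density)
  finally show ?thesis .
qed

lemma proj_density_is_density:
  assumes "is_density h" "proj_density h a k"
  shows "is_density k"
  using proj_density_has_bochner_integral_iff[OF assms, of "\<lambda>_. 1" 1] assms
  by (simp add: is_density_iff proj_density_def)

section \<open>Relative entropy and Gibbs' inequality\<close>

text \<open>Up to Lebesgue null sets, \<open>{x. q x = 0}\<close> contains every null set of the
  measure with density \<open>q\<close>, so absolute continuity can be tested on this one
  set.\<close>

lemma absolutely_continuous_density_iff:
  assumes p: "is_density p" and q: "is_density q"
  shows "absolutely_continuous (density lborel (\<lambda>x. ennreal (q x))) (density lborel (\<lambda>x. ennreal (p x)))
    \<longleftrightarrow> (AE x in lborel. q x = 0 \<longrightarrow> p x = 0)"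
proof -
  note [measurable] = is_density_measurable[OF p] is_density_measurable[OF q]
  have null: "A \<in> null_sets (density lborel (\<lambda>x. ennreal (h x))) \<longleftrightarrow>
      A \<in> sets borel \<and> (AE x in lborel. x \<in> A \<longrightarrow> h x = 0)" if "is_density h" for h :: "'a \<Rightarrow> real" and A
    using is_density_nonneg[OF that] is_density_measurable[OF that]
    by (simp add: null_sets_density_iff ennreal_eq_0_iff order_antisym_conv)
  show ?thesis
  proof
    assume ac: "absolutely_continuous (density lborel (\<lambda>x. ennreal (q x))) (density lborel (\<lambda>x. ennreal (p x)))"
    have "{x. q x = 0} \<in> null_sets (density lborel (\<lambda>x. ennreal (q x)))"
      unfolding null[OF q] by simp
    with ac have "{x. q x = 0} \<in> null_sets (density lborel (\<lambda>x. ennreal (p x)))"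
      by (auto simp: absolutely_continuous_def)
    then show "AE x in lborel. q x = 0 \<longrightarrow> p x = 0"
      unfolding null[OF p] by simp
  next
    assume "AE x in lborel. q x = 0 \<longrightarrow> p x = 0"
    then show "absolutely_continuous (density lborel (\<lambda>x. ennreal (q x))) (density lborel (\<lambda>x. ennreal (p x)))"
      unfolding absolutely_continuous_def
      by (auto simp: null[OF p] null[OF q] elim: AE_mp)
  qed
qed

text \<open>Reduces finite entropies to \<open>has_bochner_integral\<close>. Together with
  \<open>rel_entropy_cases\<close>, which excludes minus infinity, this covers every value.\<close>

lemma rel_entropy_finite_iff:
  assumes p: "is_density p" and q: "is_density q"
  shows "rel_entropy p q = ereal c \<longleftrightarrow> (AE x in lborel. q x = 0 \<longrightarrow> p x = 0) \<and>
    has_bochner_integral lborel (\<lambda>x. p x * ln (p x / q x)) c"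
  by (auto simp: rel_entropy_def absolutely_continuous_density_iff[OF p q] has_bochner_integral_iff)

lemma rel_entropy_cases:
  obtains c where "rel_entropy p q = ereal c" | "rel_entropy p q = \<infinity>"
  by (cases "rel_entropy p q") (auto simp: rel_entropy_def split: if_splits)

text \<open>This is \<open>ln y \<le> y - 1\<close> at \<open>y = q / p\<close>, multiplied by
  \<open>p\<close>. For \<open>p = 0\<close> the right-hand side is 0 and the left-hand side is
  \<open>- q\<close>.\<close>

lemma gibbs_pointwise:
  fixes p q :: real
  assumes "0 \<le> p" "0 \<le> q" "q = 0 \<longrightarrow> p = 0"
  shows "p - q \<le> p * ln (p / q)"
proof (cases "p = 0")
  case False
  with assms have pos: "0 < p" "0 < q" by auto
  then have "p * ln (q / p) \<le> p * (q / p - 1)"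
    by (intro mult_left_mono ln_le_minus_one) auto
  with pos show ?thesis
    by (simp add: ln_div algebra_simps)
qed (use assms in simp)

text \<open>Equality in \<open>ln y \<le> y - 1\<close> holds only at \<open>y = 1\<close>.\<close>

lemma gibbs_pointwise_eq:
  fixes p q :: real
  assumes "0 < p" "0 < q" "p * ln (p / q) = p - q"
  shows "p = q"
proof -
  have "p * ln (q / p) = p * (q / p - 1)"
    using assms by (simp add: ln_div algebra_simps)
  then have "ln (q / p) = q / p - 1"
    using assms by simp
  then have "q / p = 1"
    using assms by (intro ln_eq_minus_one) auto
  then show ?thesis
    using assms by simp
qed

text \<open>Integrate \<open>gibbs_pointwise\<close>: the lower bound \<open>p - q\<close> has
  integral \<open>1 - 1\<close>.\<close>

lemma rel_entropy_nonneg: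
  assumes p: "is_density p" and q: "is_density q"
  shows "0 \<le> rel_entropy p q"
proof (cases rule: rel_entropy_cases[of p q])
  case (1 c)
  then have ac: "AE x in lborel. q x = 0 \<longrightarrow> p x = 0"
    and K: "has_bochner_integral lborel (\<lambda>x. p x * ln (p x / q x)) c"
    using rel_entropy_finite_iff[OF p q] by auto
  have "AE x in lborel. p x - q x \<le> p x * ln (p x / q x)"
    using ac by eventually_elim (auto intro!: gibbs_pointwise is_density_nonneg[OF p] is_density_nonneg[OF q])
  moreover have "has_bochner_integral lborel (\<lambda>x. p x - q x) (1 - 1)"
    using p q by (intro has_bochner_integral_diff) (auto simp: is_density_iff)
  ultimately have "0 \<le> c"
    using K integral_mono_AE[of lborel "\<lambda>x. p x - q x" "\<lambda>x. p x * ln (p x / q x)"]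
    by (simp add: has_bochner_integral_iff)
  with 1 show ?thesis by simp
qed simp

text \<open>The gap \<open>?w\<close> in Gibbs' pointwise bound is nonnegative and has integral 0,
  so it vanishes almost everywhere, and there the equality case applies.\<close>

lemma rel_entropy_eq_0_imp_AE_eq:
  assumes p: "is_density p" and q: "is_density q"
    and pos: "\<And>x. 0 < p x" "\<And>x. 0 < q x"
    and 0: "rel_entropy p q = 0"
  shows "AE x in lborel. p x = q x"
proof -
  let ?w = "\<lambda>x. p x * ln (p x / q x) - (p x - q x)"
  have "has_bochner_integral lborel ?w (0 - (1 - 1))"
    using 0 p q rel_entropy_finite_iff[OF p q, of 0]
    by (intro has_bochner_integral_diff) (auto simp: is_density_iff zero_ereal_def)
  moreover have "0 \<le> ?w x" for x
    using gibbs_pointwise[of "p x" "q x"] pos[of x] by (simp add: less_imp_le)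
  ultimately have "AE x in lborel. ?w x = 0"
    by (subst integral_nonneg_eq_0_iff_AE[symmetric]) (auto simp: has_bochner_integral_iff)
  then show ?thesis
    by eventually_elim (auto intro!: gibbs_pointwise_eq pos)
qed

section \<open>Integrability of sums, and null sets under projection\<close>

text \<open>Integrable lower bounds prevent infinite parts of \<open>u\<close> and \<open>v\<close>
  from cancelling: almost everywhere \<open>u - u'\<close> lies between 0 and
  \<open>(u + v) - u' - v'\<close>.\<close>

lemma integrable_add_iff_of_lower_bounds:
  fixes u v u' v' :: "'a \<Rightarrow> real"
  assumes [measurable]: "u \<in> borel_measurable M" "v \<in> borel_measurable M"
    and u': "integrable M u'" "AE x in M. u' x \<le> u x"
    and v': "integrable M v'" "AE x in M. v' x \<le> v x"
  shows "integrable M (\<lambda>x. u x + v x) \<longleftrightarrow> integrable M u \<and> integrable M v"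
proof safe
  assume uv: "integrable M (\<lambda>x. u x + v x)"
  have *: "integrable M (\<lambda>x. (u x + v x) - u' x - v' x)"
    using uv u' v' by simp
  have "integrable M (\<lambda>x. u x - u' x)"
    by (rule Bochner_Integration.integrable_bound[OF *])
      (use u' v' in \<open>auto elim!: eventually_elim2\<close>)
  from Bochner_Integration.integrable_add[OF this u'(1)] show u: "integrable M u"
    by simp
  from Bochner_Integration.integrable_diff[OF uv u] show "integrable M v"
    by simp
qed simp

text \<open>By translation invariance, \<open>lborel {x. a \<bullet> (x + t a) \<in> N}\<close> does not depend on \<open>t\<close>; by Fubini,
  its integral over \<open>t\<close> vanishes.\<close>

lemma AE_inner_of_AE:
  fixes a :: "'a::euclidean_space"
  assumes "a \<noteq> 0" and ae: "AE t in lborel. P (t :: real)"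
    and P: "Measurable.pred borel P"
  shows "AE x in lborel. P (a \<bullet> x)"
proof -
  note [measurable] = P
  define c where "c = (\<integral>\<^sup>+x. indicator {t. \<not> P t} (a \<bullet> x) \<partial>(lborel :: 'a measure))"
  have shift: "(\<integral>\<^sup>+x. indicator {t. \<not> P t} (a \<bullet> (t *\<^sub>R a + x)) \<partial>(lborel :: 'a measure)) = c" for t
  proof -
    have "c = (\<integral>\<^sup>+x. indicator {t. \<not> P t} (a \<bullet> x) \<partial>distr lborel borel ((+) (t *\<^sub>R a)))"
      by (simp add: c_def lborel_distr_plus)
    then show ?thesis
      by (simp add: nn_integral_distr)
  qed
  have line: "(\<integral>\<^sup>+t. indicator {t. \<not> P t} (a \<bullet> (t *\<^sub>R a + x)) \<partial>lborel) = (0 :: ennreal)" for x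
  proof -
    \<comment> \<open>On the line \<open>t *\<^sub>R a + x\<close> the projection is affine in
      \<open>t\<close> with slope \<open>a \<bullet> a\<close>, which is nonzero, so the exceptional
      set pulls back to a null set.\<close>
    have "(\<integral>\<^sup>+t. indicator {t. \<not> P t} t \<partial>lborel) =
        ennreal \<bar>a \<bullet> a\<bar> * (\<integral>\<^sup>+t. indicator {t. \<not> P t} (a \<bullet> x + (a \<bullet> a) * t) \<partial>lborel)"
      using assms(1) by (intro nn_integral_real_affine) auto
    moreover have "(\<integral>\<^sup>+t. indicator {t. \<not> P t} t \<partial>lborel) = (0 :: ennreal)"
      using ae by (subst nn_integral_0_iff_AE) (auto simp: indicator_def elim: eventually_mono)
    ultimately show ?thesis
      using assms(1) by (simp add: inner_add_right algebra_simps)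
  qed
  have "(\<integral>\<^sup>+t. c \<partial>(lborel :: real measure)) =
      (\<integral>\<^sup>+t. (\<integral>\<^sup>+x. indicator {t. \<not> P t} (a \<bullet> (t *\<^sub>R a + x)) \<partial>(lborel :: 'a measure)) \<partial>lborel)"
    by (simp add: shift)
  also have "\<dots> = (\<integral>\<^sup>+x. (\<integral>\<^sup>+t. indicator {t. \<not> P t} (a \<bullet> (t *\<^sub>R a + x)) \<partial>lborel) \<partial>lborel)"
    by (rule lborel_pair.Fubini') measurable
  also have "\<dots> = 0"
    by (simp add: line)
  \<comment> \<open>The integral of the constant \<open>c\<close> over the whole line is
    \<open>c\<close> times infinity, which is 0 only for \<open>c = 0\<close>.\<close>
  finally have "c = 0"
    by (simp add: ennreal_mult_eq_top_iff split: if_splits)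
  then show ?thesis
    unfolding c_def by (subst (asm) nn_integral_0_iff_AE) (auto simp: indicator_eq_0_iff)
qed

section \<open>The entropy decomposition in a fixed direction\<close>

text \<open>The projected densities are positive everywhere, so that \<open>fa / ga\<close> is a
  positive function on the whole line, as membership in \<open>ridge_class\<close> demands.\<close>

locale projected_densities =
  fixes f g :: "'a::euclidean_space \<Rightarrow> real" and a :: 'a and fa ga :: "real \<Rightarrow> real"
  assumes f: "is_density f" and g: "is_density g"
    and fa: "proj_density f a fa" and ga: "proj_density g a ga"
    and fa_pos: "0 < fa t" and ga_pos: "0 < ga t"
begin

lemmas [measurable] = is_density_measurable[OF f] is_density_measurable[OF g]
  proj_density_measurable[OF fa] proj_density_measurable[OF ga]

lemma ga_density: "is_density ga"
  by (rule proj_density_is_density[OF g ga])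

text \<open>Projecting turns the integral of \<open>f\<close> times \<open>ga / fa\<close> into that
  of \<open>fa * (ga / fa) = ga\<close>, which is 1.\<close>

lemma quotient_in_ridge_class: "(\<lambda>t. fa t / ga t) \<in> ridge_class f a"
proof -
  have "fa t * (ga t / fa t) = ga t" for t
    using fa_pos[of t] by simp
  then have "has_bochner_integral lborel (\<lambda>x. f x * (ga (a \<bullet> x) / fa (a \<bullet> x))) 1"
    using ga_density by (subst proj_density_has_bochner_integral_iff[OF f fa]) (auto simp: is_density_iff)
  then show ?thesis
    using fa_pos ga_pos is_density_nonneg[OF f]
    by (auto simp: ridge_class_def ridge_quotient_def is_density_iff less_imp_le)
qed

text \<open>The factor \<open>1 / r\<close> depends on \<open>a \<bullet> x\<close> alone, so it
  passes through the projection and the total mass is preserved.\<close>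

lemma line_quotient_density:
  assumes "r \<in> ridge_class f a"
  shows "is_density (\<lambda>t. fa t / r t)"
proof -
  have [measurable]: "r \<in> borel_measurable borel" and r0: "\<And>t. 0 < r t"
    and "is_density (ridge_quotient f a r)"
    using assms by (auto simp: ridge_class_def)
  then have "has_bochner_integral lborel (\<lambda>x. f x * inverse (r (a \<bullet> x))) 1"
    by (simp add: is_density_iff ridge_quotient_def)
  then have "has_bochner_integral lborel (\<lambda>t. fa t * inverse (r t)) 1"
    by (subst (asm) proj_density_has_bochner_integral_iff[OF f fa]) auto
  then show ?thesis
    using r0 fa_pos by (simp add: is_density_iff divide_inverse less_imp_le)
qed

text \<open>The logarithm of the factorisation splits the integrand into \<open>u + v\<close>, and
  \<open>v\<close> reduces to an integral on the line. Most of the work is to show that both sides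
  are infinite together.\<close>

lemma rel_entropy_ridge_quotient:
  assumes r: "r \<in> ridge_class f a"
  shows "rel_entropy g (ridge_quotient f a r) =
    rel_entropy g (ridge_quotient f a (\<lambda>t. fa t / ga t)) + rel_entropy ga (\<lambda>t. fa t / r t)"
proof -
  define s where "s = (\<lambda>t. fa t / r t)"
  define q where "q = ridge_quotient f a r"
  define q' where "q' = ridge_quotient f a (\<lambda>t. fa t / ga t)"
  define u where "u = (\<lambda>x. g x * ln (g x / q' x))"
  define v where "v = (\<lambda>x. g x * ln (ga (a \<bullet> x) / s (a \<bullet> x)))"
  have [measurable]: "r \<in> borel_measurable borel" and r0: "\<And>t. 0 < r t" and q: "is_density q"
    using r by (auto simp: ridge_class_def q_def)
  have q': "is_density q'"
    using quotient_in_ridge_class by (simp add: ridge_class_def q'_def)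
  have s: "is_density s"
    unfolding s_def by (rule line_quotient_density[OF r])
  note [measurable] = is_density_measurable[OF q] is_density_measurable[OF q'] is_density_measurable[OF s]
  have s_pos: "0 < s t" for t
    using r0 fa_pos by (simp add: s_def)
  \<comment> \<open>The densities differ from \<open>f\<close> by positive factors, so absolute
    continuity of \<open>g\<close> is the same condition for \<open>q\<close> and
    \<open>q'\<close>.\<close>
  have q_eq0: "q x = 0 \<longleftrightarrow> f x = 0" "q' x = 0 \<longleftrightarrow> f x = 0" for x
    using r0[of "a \<bullet> x"] fa_pos[of "a \<bullet> x"] ga_pos[of "a \<bullet> x"]
    by (auto simp: q_def q'_def ridge_quotient_def)
  \<comment> \<open>Since \<open>s\<close> is positive, the absolute continuity clause for
    \<open>ga\<close> and \<open>s\<close> holds trivially.\<close>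
  have v_iff: "has_bochner_integral lborel v c \<longleftrightarrow> rel_entropy ga s = ereal c" for c
    unfolding v_def
    by (subst proj_density_has_bochner_integral_iff[OF g ga, where \<phi> = "\<lambda>t. ln (ga t / s t)"])
      (simp_all add: rel_entropy_finite_iff[OF ga_density s] less_imp_neq[OF s_pos, symmetric])
  show ?thesis
  proof (cases "AE x in lborel. f x = 0 \<longrightarrow> g x = 0")
    case False
    \<comment> \<open>Both sides are infinite here, because the remaining summand is not minus
      infinity.\<close>
    then have "rel_entropy g q = \<infinity>" "rel_entropy g q' = \<infinity>"
      by (auto simp: rel_entropy_def absolutely_continuous_density_iff[OF g q]
          absolutely_continuous_density_iff[OF g q'] q_eq0)
    then show ?thesis
      by (cases rule: rel_entropy_cases[of ga s]) (auto simp: q_def q'_def s_def)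
  next
    case ac: True
    have u_iff: "has_bochner_integral lborel u c \<longleftrightarrow> rel_entropy g q' = ereal c" for c
      using ac by (simp add: rel_entropy_finite_iff[OF g q'] u_def q_eq0)
    \<comment> \<open>Where \<open>g\<close> vanishes, all three terms are 0; elsewhere
      \<open>f\<close> is positive and the logarithm of the product splits.\<close>
    have split: "AE x in lborel. g x * ln (g x / q x) = u x + v x"
      using ac
    proof eventually_elim
      case (elim x)
      show ?case
      proof (cases "g x = 0")
        case False
        with elim have "0 < g x" "0 < f x"
          using is_density_nonneg[OF g, of x] is_density_nonneg[OF f, of x] by auto
        then show ?thesis
          using r0[of "a \<bullet> x"] fa_pos[of "a \<bullet> x"] ga_pos[of "a \<bullet> x"]
          by (simp add: u_def v_def q_def q'_def s_def ridge_quotient_def ln_div ln_mult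
              ln_inverse algebra_simps)
      qed (simp add: u_def v_def)
    qed
    have uv_iff: "has_bochner_integral lborel (\<lambda>x. u x + v x) c \<longleftrightarrow> rel_entropy g q = ereal c" for c
      unfolding rel_entropy_finite_iff[OF g q]
      using ac split
      by (simp add: q_eq0) (intro has_bochner_integral_cong_AE, auto simp: u_def v_def)
    have u_lower: "AE x in lborel. g x - q' x \<le> u x"
      using ac unfolding u_def
      by eventually_elim (auto intro!: gibbs_pointwise is_density_nonneg[OF g] is_density_nonneg[OF q'] simp: q_eq0)
    \<comment> \<open>Gibbs' bound with \<open>p = 1\<close>, weighted by \<open>g x\<close>, gives
      a lower bound whose integral can be computed by projection.\<close>
    have v_lower: "g x - g x * (s (a \<bullet> x) / ga (a \<bullet> x)) \<le> v x" for x
    proof -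
      have "g x * (1 - s (a \<bullet> x) / ga (a \<bullet> x)) \<le> g x * ln (ga (a \<bullet> x) / s (a \<bullet> x))"
        using gibbs_pointwise[of 1 "s (a \<bullet> x) / ga (a \<bullet> x)"] s_pos[of "a \<bullet> x"] ga_pos[of "a \<bullet> x"]
        by (intro mult_left_mono is_density_nonneg g) auto
      then show ?thesis
        by (simp add: v_def algebra_simps)
    qed
    have "ga t * (s t / ga t) = s t" for t
      using ga_pos[of t] by simp
    then have "has_bochner_integral lborel (\<lambda>x. g x * (s (a \<bullet> x) / ga (a \<bullet> x))) 1"
      using s by (subst proj_density_has_bochner_integral_iff[OF g ga]) (auto simp: is_density_iff)
    then have "integrable lborel (\<lambda>x. g x - g x * (s (a \<bullet> x) / ga (a \<bullet> x)))"
      using g by (intro Bochner_Integration.integrable_diff) (auto simp: is_density_iff has_bochner_integral_iff)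
    moreover have "integrable lborel (\<lambda>x. g x - q' x)"
      using g q' by (intro Bochner_Integration.integrable_diff) (auto simp: is_density_iff has_bochner_integral_iff)
    \<comment> \<open>Both lower bounds are differences of integrable functions, so \<open>u\<close>
      and \<open>v\<close> cannot cancel.\<close>
    ultimately have int_iff: "integrable lborel (\<lambda>x. u x + v x) \<longleftrightarrow> integrable lborel u \<and> integrable lborel v"
      using u_lower v_lower
      by (intro integrable_add_iff_of_lower_bounds) (auto simp: u_def v_def)
    show ?thesis
    proof (cases "integrable lborel u \<and> integrable lborel v")
      case True
      then have "rel_entropy g q' = ereal (integral\<^sup>L lborel u)" "rel_entropy ga s = ereal (integral\<^sup>L lborel v)"
        "rel_entropy g q = ereal (integral\<^sup>L lborel u + integral\<^sup>L lborel v)"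
        using u_iff v_iff uv_iff by (auto simp: has_bochner_integral_iff)
      then show ?thesis
        by (simp add: q_def q'_def s_def)
    next
      case False
      \<comment> \<open>One infinite summand makes the sum infinite, as neither can be minus
        infinity.\<close>
      then have "rel_entropy g q = \<infinity>" "rel_entropy g q' = \<infinity> \<or> rel_entropy ga s = \<infinity>"
        using u_iff v_iff uv_iff int_iff rel_entropy_cases[of g q] rel_entropy_cases[of g q']
          rel_entropy_cases[of ga s]
        by (auto simp: has_bochner_integral_iff) metis+
      then show ?thesis
        using rel_entropy_cases[of g q'] rel_entropy_cases[of ga s]
        by (auto simp: q_def q'_def s_def) 
    qed
  qed
qed

lemma rel_entropy_decomposition:
  "rel_entropy g f = rel_entropy ga fa + rel_entropy g (ridge_quotient f a (\<lambda>t. fa t / ga t))"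
proof -
  have "ridge_quotient f a (\<lambda>_. 1) = f"
    by (simp add: ridge_quotient_def)
  moreover from this have "(\<lambda>_. 1) \<in> ridge_class f a"
    using f by (simp add: ridge_class_def)
  ultimately show ?thesis
    using rel_entropy_ridge_quotient[of "\<lambda>_. 1"] by (simp add: add.commute)
qed

text \<open>In the decomposition only the last summand depends on \<open>r\<close>, and it is
  nonnegative.\<close>

lemma quotient_is_arg_min:
  "is_arg_min (\<lambda>r. rel_entropy g (ridge_quotient f a r)) (\<lambda>r. r \<in> ridge_class f a) (\<lambda>t. fa t / ga t)"
  unfolding is_arg_min_linorder
proof (intro conjI allI impI quotient_in_ridge_class)
  fix r assume r: "r \<in> ridge_class f a"
  show "rel_entropy g (ridge_quotient f a (\<lambda>t. fa t / ga t)) \<le> rel_entropy g (ridge_quotient f a r)"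
    unfolding rel_entropy_ridge_quotient[OF r]
    by (rule add_increasing2[OF rel_entropy_nonneg[OF ga_density line_quotient_density[OF r]] order_refl])
qed

text \<open>Finiteness allows the common summand to be cancelled, leaving entropy 0 between
  \<open>ga\<close> and \<open>fa / r\<close>. If the minimum were infinite, every member of the
  class would be a minimiser.\<close>

lemma arg_min_AE_unique:
  assumes min: "is_arg_min (\<lambda>r. rel_entropy g (ridge_quotient f a r)) (\<lambda>r. r \<in> ridge_class f a) r"
    and fin: "rel_entropy g (ridge_quotient f a r) < \<infinity>"
  shows "AE t in lborel. r t = fa t / ga t"
proof -
  have r: "r \<in> ridge_class f a"
    and le: "rel_entropy g (ridge_quotient f a r) \<le> rel_entropy g (ridge_quotient f a (\<lambda>t. fa t / ga t))"
    using min quotient_in_ridge_class by (auto simp: is_arg_min_linorder)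
  have r0: "0 < r t" for t
    using r by (simp add: ridge_class_def)
  note s = line_quotient_density[OF r]
  have "rel_entropy ga (\<lambda>t. fa t / r t) = 0"
    using le fin rel_entropy_nonneg[OF ga_density s] unfolding rel_entropy_ridge_quotient[OF r]
    by (cases rule: rel_entropy_cases[of ga "\<lambda>t. fa t / r t"];
        cases rule: rel_entropy_cases[of g "ridge_quotient f a (\<lambda>t. fa t / ga t)"]) auto
  then have "AE t in lborel. ga t = fa t / r t"
    using r0 fa_pos ga_pos by (intro rel_entropy_eq_0_imp_AE_eq ga_density s) auto
  then show ?thesis
  proof eventually_elim
    case (elim t)
    then show ?case
      using r0[of t] fa_pos[of t] by (metis ga_pos divide_eq_eq less_irrefl mult.commute nonzero_mult_div_cancel_right)
  qed
qed

end

section \<open>Choice of a direction and conclusion\<close>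

theorem proposition7:
  fixes f g :: "real^'n \<Rightarrow> real"
    and f_proj g_proj :: "real^'n \<Rightarrow> real \<Rightarrow> real"
  assumes "is_density f" and "elliptical_density g"
    and "finite_second_moment f" and "finite_second_moment g"
    and "mean_of g = mean_of f" and "variance_of g = variance_of f"
    and "\<And>a. a \<noteq> 0 \<Longrightarrow> proj_density f a (f_proj a)"
    and "\<And>a. a \<noteq> 0 \<Longrightarrow> proj_density g a (g_proj a)"
    and "\<And>a t. a \<noteq> 0 \<Longrightarrow> 0 < f_proj a t"
    and "\<And>a t. a \<noteq> 0 \<Longrightarrow> 0 < g_proj a t"
  shows "\<exists>a. a \<noteq> 0 \<and>
      is_arg_min (\<lambda>r. rel_entropy g (ridge_quotient f a r)) (\<lambda>r. r \<in> ridge_class f a)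
        (\<lambda>t. f_proj a t / g_proj a t) \<and>
      (\<forall>r. is_arg_min (\<lambda>r. rel_entropy g (ridge_quotient f a r)) (\<lambda>r. r \<in> ridge_class f a) r \<and>
           rel_entropy g (ridge_quotient f a r) < \<infinity> \<longrightarrow>
         (AE t in lborel. r t = f_proj a t / g_proj a t) \<and>
         (AE x in lborel. r (a \<bullet> x) = f_proj a (a \<bullet> x) / g_proj a (a \<bullet> x))) \<and>
      rel_entropy g f = rel_entropy (g_proj a) (f_proj a)
        + rel_entropy g (\<lambda>x. f x * (g_proj a (a \<bullet> x) / f_proj a (a \<bullet> x)))"
proof -
  \<comment> \<open>The argument works for every nonzero direction; a basis vector serves as
    witness.\<close>
  obtain a :: "real^'n" where a: "a \<noteq> 0"
    using nonzero_Basis nonempty_Basis by blast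
  interpret projected_densities f g a "f_proj a" "g_proj a"
    using assms a by unfold_locales (auto simp: elliptical_density_def)
  let ?q = "\<lambda>t. f_proj a t / g_proj a t"
  have ridge: "ridge_quotient f a ?q = (\<lambda>x. f x * (g_proj a (a \<bullet> x) / f_proj a (a \<bullet> x)))"
    by (simp add: ridge_quotient_def)
  have uniq: "(AE t in lborel. r t = ?q t) \<and> (AE x in lborel. r (a \<bullet> x) = ?q (a \<bullet> x))"
    if "is_arg_min (\<lambda>r. rel_entropy g (ridge_quotient f a r)) (\<lambda>r. r \<in> ridge_class f a) r"
      "rel_entropy g (ridge_quotient f a r) < \<infinity>" for r
  proof -
    have [measurable]: "r \<in> borel_measurable borel"
      using that(1) by (simp add: is_arg_min_def ridge_class_def)
    \<comment> \<open>Measurability of the equality set lets the almost everywhere statement pass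
      from the line to the space.\<close>
    have "Measurable.pred borel (\<lambda>t. r t = ?q t)"
      by measurable
    with arg_min_AE_unique[OF that] show ?thesis
      using AE_inner_of_AE[OF a, of "\<lambda>t. r t = ?q t"] by blast
  qed
  show ?thesis
    using a quotient_is_arg_min uniq rel_entropy_decomposition unfolding ridge by blast
qed

end
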